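(* Let $k\ge1$ and $0\le n,l\le k$. For generic parameters $\alpha,\beta,\gamma,\delta$, $$\sum_{m=0}^kR_n^m(\alpha,\beta,\gamma,\delta;k;q,p)\,R_m^l(\gamma,\delta,\alpha,\beta;k;q,p)=\delta_{n,l},$$ where $\delta_{n,l}$ on the right is the Kronecker delta.
   Context: Fix $\tau\in\mathbb{C}$ with $\mathrm{Im}\,\tau>0$ and a nonzero parameter $r$; put $\tilde p=e^{2\pi i\tau}$, $x=e^{-\pi i/(r\tau)}$ (powers $x^s=e^{-\pi i s/(r\tau)}$), $q=-x$, $p=x^{2r}$ (the letters $q,p$ in $R_n^m$ only record these fixed parameters). Let $\vartheta_1(u|\tau)=2\tilde p^{1/8}(\tilde p;\tilde p)_\infty\sin\pi u\prod_{n\ge1}(1-2\tilde p^n\cos 2\pi u+\tilde p^{2n})$, $[u]=C\,\vartheta_1(\frac{u}{r}|\tau)$ with $C=x^{-r/4}e^{-\pi i/4}\tau^{1/2}$, and $[u]_n=\prod_{j=0}^{n-1}[u+j]$. Let $\Theta_k$ be the $(k+1)$-dimensional space of entire $f$ with $f(z+1)=f(z)$, $f(z+\tau)=e^{-2\pi ik(2z+\tau)}f(z)$, $f(-z)=f(z)$. For $0\le n\le k$ put $e^k_n(z;\alpha,\beta)=[\alpha+rz]_n[\alpha-rz]_n[\beta+rz]_{k-n}[\beta-rz]_{k-n}\in\Theta_k$. These form a basis of $\Theta_k$ (natural basis) if $$\tfrac{\alpha-\beta+j}{r}\notin\mathbb{Z}+\tau\mathbb{Z}\ (j=1-k,\dots,k-1),\qquad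 \tfrac{\alpha+\beta+j}{r}\notin\mathbb{Z}+\tau\mathbb{Z}\ (j=0,\dots,k-1).$$ The elliptic $6j$-symbols $R_n^m$ are defined by $$e^k_n(z;\alpha,\beta)=\sum_{m=0}^kR_n^m(\alpha,\beta,\gamma,\delta;k;q,p)\,e^k_m(z;\gamma,\delta).$$ "Generic" means that both pairs $(\alpha,\beta)$ and $(\gamma,\delta)$ satisfy the basis conditions above. *)

theory Defs
  imports "HOL-Analysis.Analysis"
begin

definition nome :: "complex \<Rightarrow> complex" where
  "nome \<tau> = exp (2 * of_real pi * \<i> * \<tau>)"

text \<open>
  The factor \<open>exp (\<pi> \<i> \<tau> / 4)\<close> is the branch \<open>exp (2 \<pi> \<i> \<tau> (1/8))\<close> of the eighth
  root of the nome. Products over \<open>n \<ge> 1\<close> are indexed by \<open>Suc n\<close>.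
\<close>
definition theta1 :: "complex \<Rightarrow> complex \<Rightarrow> complex" where
  "theta1 \<tau> u =
     2 * exp (of_real pi * \<i> * \<tau> / 4) * (\<Prod>n. 1 - nome \<tau> ^ Suc n) * sin (of_real pi * u)
     * (\<Prod>n. 1 - 2 * nome \<tau> ^ Suc n * cos (2 * of_real pi * u) + nome \<tau> ^ (2 * Suc n))"

text \<open>The power \<open>x\<^sup>s\<close> for \<open>x = exp (- \<pi> \<i> / (r \<tau>))\<close>.\<close>
definition x_pow :: "complex \<Rightarrow> complex \<Rightarrow> complex \<Rightarrow> complex" where
  "x_pow \<tau> r s = exp (- (of_real pi * \<i> * s) / (r * \<tau>))"

definition bracket_const :: "complex \<Rightarrow> complex \<Rightarrow> complex" where
  "bracket_const \<tau> r = x_pow \<tau> r (- r / 4) * exp (- (of_real pi * \<i>) / 4) * csqrt \<tau>"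

definition bracket :: "complex \<Rightarrow> complex \<Rightarrow> complex \<Rightarrow> complex" where
  "bracket \<tau> r u = bracket_const \<tau> r * theta1 \<tau> (u / r)"

definition bracket_fact :: "complex \<Rightarrow> complex \<Rightarrow> complex \<Rightarrow> nat \<Rightarrow> complex" where
  "bracket_fact \<tau> r u n = (\<Prod>j<n. bracket \<tau> r (u + of_nat j))"

text \<open>The function \<open>e\<^sup>k\<^sub>n(z; \<alpha>, \<beta>)\<close>, intended for \<open>n \<le> k\<close>.\<close>
definition e_fun ::
  "complex \<Rightarrow> complex \<Rightarrow> nat \<Rightarrow> nat \<Rightarrow> complex \<Rightarrow> complex \<Rightarrow> complex \<Rightarrow> complex" where
  "e_fun \<tau> r k n z \<alpha> \<beta> =
     bracket_fact \<tau> r (\<alpha> + r * z) n * bracket_fact \<tau> r (\<alpha> - r * z) n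
     * bracket_fact \<tau> r (\<beta> + r * z) (k - n) * bracket_fact \<tau> r (\<beta> - r * z) (k - n)"

definition period_lattice :: "complex \<Rightarrow> complex set" where
  "period_lattice \<tau> = {of_int a + of_int b * \<tau> | a b. True}"

definition generic_pair :: "complex \<Rightarrow> complex \<Rightarrow> nat \<Rightarrow> complex \<Rightarrow> complex \<Rightarrow> bool" where
  "generic_pair \<tau> r k \<alpha> \<beta> \<longleftrightarrow>
     (\<forall>j\<in>{1 - int k..int k - 1}. (\<alpha> - \<beta> + of_int j) / r \<notin> period_lattice \<tau>) \<and>
     (\<forall>j\<in>{0..int k - 1}. (\<alpha> + \<beta> + of_int j) / r \<notin> period_lattice \<tau>)"

text \<open>
  \<open>elliptic_6j \<tau> r k n m \<alpha> \<beta> \<gamma> \<delta>\<close> is \<open>R\<^sub>n\<^sup>m(\<alpha>, \<beta>, \<gamma>, \<delta>; k; q, p)\<close> with \<open>q = - x\<close> and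
  \<open>p = x\<^sup>2\<^sup>r\<close>; these two only record \<open>\<tau>\<close> and \<open>r\<close>, which are the actual arguments here.
  The definite description selects the coefficients, extended by \<open>0\<close> beyond \<open>k\<close>, in an
  expansion valid for all \<open>z\<close>; it is meaningful when \<open>(\<gamma>, \<delta>)\<close> is generic and \<open>n \<le> k\<close>.
\<close>
definition elliptic_6j ::
  "complex \<Rightarrow> complex \<Rightarrow> nat \<Rightarrow> nat \<Rightarrow> nat \<Rightarrow> complex \<Rightarrow> complex \<Rightarrow> complex \<Rightarrow> complex \<Rightarrow> complex"
where
  "elliptic_6j \<tau> r k n m \<alpha> \<beta> \<gamma> \<delta> =
     (THE R :: nat \<Rightarrow> complex.
        (\<forall>j>k. R j = 0) \<and>
        (\<forall>z. e_fun \<tau> r k n z \<alpha> \<beta> = (\<Sum>j=0..k. R j * e_fun \<tau> r k j z \<gamma> \<delta>))) m"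

end

theory Submission
  imports Defs "HOL-Complex_Analysis.Cauchy_Integral_Formula"
begin

text \<open>
  Both families \<open>e\<^sup>k\<^sub>n(\<cdot>; \<alpha>, \<beta>)\<close> and \<open>e\<^sup>k\<^sub>n(\<cdot>; \<gamma>, \<delta>)\<close> are bases of the same
  space of functions, and the two matrices of elliptic 6j-symbols are the changes of basis in the
  two directions, hence inverse to each other. What needs an argument is that each family is
  linearly independent and that it spans the other one.

  Up to a nonzero constant, every \<open>e\<^sup>k\<^sub>n\<close> is a product of \<open>k\<close> factors
  \<open>\<phi>\<^sub>a(z) = \<theta>(a + z) \<theta>(a - z)\<close>, written \<open>theta_pair a z\<close>. Weierstrass' three-term
  identity \<open>weierstrass_three_term\<close> says that \<open>\<phi>\<^sub>c\<close> is a linear combination of \<open>\<phi>\<^sub>a\<close>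
  and \<open>\<phi>\<^sub>b\<close> as soon as \<open>a + b\<close> and \<open>a - b\<close> are not periods.

  Spanning (\<open>prod_bracket_pair_expansion\<close>): any product of \<open>k\<close> factors expands in the family
  for \<open>(\<gamma>, \<delta>)\<close>, by induction on \<open>k\<close>. When one more factor is multiplied to
  \<open>e\<^sup>k\<^sub>j(\<cdot>; \<gamma>, \<delta>)\<close>, rewrite it through exactly those two factors that turn
  \<open>e\<^sup>k\<^sub>j\<close> into \<open>e\<^sup>k\<^sup>+\<^sup>1\<^sub>j\<^sub>+\<^sub>1\<close> and into \<open>e\<^sup>k\<^sup>+\<^sup>1\<^sub>j\<close>; the conditions
  under which this is possible are among the genericity conditions.

  Independence (\<open>e_fun_independent\<close>): at \<open>z = \<gamma>/r\<close> every \<open>e\<^sup>k\<^sub>n\<close> with \<open>n \<ge> 1\<close> vanishes and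
  \<open>e\<^sup>k\<^sub>0\<close> does not, so the coefficient of \<open>e\<^sup>k\<^sub>0\<close> is zero; cancelling the factor common
  to all the other terms leaves a relation of degree \<open>k - 1\<close> for the generic pair
  \<open>(\<gamma> + 1, \<delta>)\<close>.

  The three-term identity itself comes from Liouville's theorem. As a function of \<open>z\<close>, its left
  side is entire, has the same quasi-periods as \<open>\<phi>\<^sub>a\<close> and vanishes wherever \<open>\<phi>\<^sub>a\<close> does. For all
  \<open>a\<close> outside a countable set these zeros are simple and \<open>\<phi>\<^sub>a(b) \<noteq> 0\<close>; then the quotient is entire
  and doubly periodic, hence constant, and it vanishes at \<open>z = b\<close>. The excluded values of \<open>a\<close>
  follow by continuity. The zeros of \<open>\<theta>\<close>, their simplicity and its quasi-periods are
  read off the product expansion.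
\<close>

section \<open>The infinite product with zeros along a geometric progression\<close>

text \<open>
  This is the q-Pochhammer symbol \<open>(w; q)\<^sub>\<infinity>\<close>.
\<close>

definition q_prod :: "complex \<Rightarrow> complex \<Rightarrow> complex" where
  "q_prod q w = (\<Prod>n. 1 - q ^ n * w)"

lemma q_prod_convergent:
  fixes q w :: complex
  assumes "norm q < 1"
  shows "convergent_prod (\<lambda>n. 1 - q ^ n * w)"
proof -
  have "summable (\<lambda>n. norm (q ^ n * w))"
    unfolding norm_mult norm_power using assms by (intro summable_mult2) (simp add: summable_geometric)
  then show ?thesis
    by (intro abs_convergent_prod_imp_convergent_prod summable_imp_abs_convergent_prod) simp
qed

lemma q_prod_step:
  assumes "norm q < 1"
  shows "q_prod q w = (1 - w) * q_prod q (q * w)"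
proof -
  have "(\<lambda>n. 1 - q ^ Suc n * w) has_prod q_prod q (q * w)"
    using convergent_prod_has_prod[OF q_prod_convergent[OF assms, of "q * w"]]
    by (simp add: q_prod_def mult_ac)
  from has_prod_unique[OF has_prod_Suc_imp[OF this]] show ?thesis
    by (simp add: q_prod_def mult_ac)
qed

lemma q_prod_nonzero:
  assumes "norm q < 1" "\<And>n. q ^ n * w \<noteq> 1"
  shows "q_prod q w \<noteq> 0"
  unfolding q_prod_def
proof (intro prodinf_nonzero q_prod_convergent assms(1))
  show "1 - q ^ n * w \<noteq> 0" for n
    using assms(2)[of n] by (metis eq_iff_diff_eq_0)
qed

lemma q_prod_holomorphic:
  assumes "norm q < 1"
  shows "q_prod q holomorphic_on UNIV"
proof (rule holomorphic_uniform_sequence)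
  define F where "F = (\<lambda>N w. \<Prod>n<N. 1 - q ^ n * w)"
  show "F N holomorphic_on UNIV" for N
    unfolding F_def by (intro holomorphic_intros)
  fix z :: complex
  have "uniformly_convergent_on (cball z 1) F"
    unfolding F_def
  proof (rule uniformly_convergent_on_prod')
    show "uniformly_convergent_on (cball z 1) (\<lambda>N x. \<Sum>n<N. norm (1 - q ^ n * x - 1))"
    proof (rule Weierstrass_m_test')
      fix n x assume "x \<in> cball z 1"
      then have "norm x \<le> norm z + 1"
        by (smt (verit, best) dist_norm mem_cball norm_minus_commute norm_triangle_sub)
      then show "norm (norm (1 - q ^ n * x - 1)) \<le> norm q ^ n * (norm z + 1)"
        by (simp add: norm_mult norm_power mult_left_mono)
    qed (use assms in \<open>auto intro!: summable_mult2\<close>)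
  qed (auto intro!: continuous_intros)
  then obtain g where g: "uniform_limit (cball z 1) F g sequentially"
    by (auto simp: uniformly_convergent_on_def)
  have "g w = q_prod q w" if "w \<in> cball z 1" for w
  proof -
    have "(\<lambda>n. F (Suc n) w) \<longlonglongrightarrow> g w"
      using tendsto_uniform_limitI[OF g that] filterlim_sequentially_Suc[of "\<lambda>n. F n w"] by simp
    moreover have "(\<lambda>n. F (Suc n) w) \<longlonglongrightarrow> q_prod q w"
      using convergent_prod_LIMSEQ[OF q_prod_convergent[OF assms]]
      by (simp add: F_def q_prod_def lessThan_Suc_atMost)
    ultimately show ?thesis by (rule LIMSEQ_unique)
  qed
  then have "uniform_limit (cball z 1) F (q_prod q) sequentially"
    using g uniform_limit_cong'[of "cball z 1" F F g "q_prod q"] by simp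
  then show "\<exists>d>0. cball z d \<subseteq> UNIV \<and> uniform_limit (cball z d) F (q_prod q) sequentially"
    by (intro exI[of _ 1]) auto
qed auto

section \<open>The Jacobi theta function\<close>

locale upper_half_plane =
  fixes \<tau> :: complex
  assumes Im_tau: "Im \<tau> > 0"
begin

lemma nome_nonzero: "nome \<tau> \<noteq> 0"
  by (simp add: nome_def)

lemma norm_nome: "norm (nome \<tau>) < 1"
  using Im_tau by (simp add: nome_def norm_exp)

lemma nome_power: "nome \<tau> ^ n = exp (2 * of_real pi * \<i> * (of_nat n * \<tau>))"
  by (simp add: nome_def exp_of_nat_mult[symmetric] mult_ac)

text \<open>
  The factor of \<open>theta1\<close> that is independent of the argument, once \<open>2 sin(\<pi> u)\<close> is written as
  \<open>\<i> exp(- \<pi> \<i> u) (1 - w)\<close> with \<open>w = exp(2 \<pi> \<i> u)\<close> and \<open>1 - w\<close> is absorbed into a product.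
\<close>

definition theta1_scale :: complex where
  "theta1_scale = \<i> * exp (of_real pi * \<i> * \<tau> / 4) * q_prod (nome \<tau>) (nome \<tau>)"

lemma theta1_scale_nonzero: "theta1_scale \<noteq> 0"
proof -
  have "nome \<tau> ^ n * nome \<tau> \<noteq> 1" for n
  proof
    assume "nome \<tau> ^ n * nome \<tau> = 1"
    then have "norm (nome \<tau>) ^ Suc n = 1"
      by (metis norm_one norm_power power_Suc2)
    then show False
      using power_Suc_less_one[of "norm (nome \<tau>)" n] norm_nome nome_nonzero by simp
  qed
  then show ?thesis
    using q_prod_nonzero[OF norm_nome] by (simp add: theta1_scale_def)
qed

text \<open>
  With \<open>w = exp(2 \<pi> \<i> u)\<close>, each quadratic factor splits as
  \<open>(1 - p\<^sup>n w) (1 - p\<^sup>n / w)\<close>, and the factor \<open>1 - w\<close> of the sine is the missing \<open>n = 0\<close> factor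
  of the first product. In this form the shift by \<open>\<tau>\<close> becomes the shift \<open>w \<mapsto> p w\<close>, and
  the zeros are visible.
\<close>

lemma theta1_eq_q_prod:
  fixes u defines "w \<equiv> exp (2 * of_real pi * \<i> * u)"
  shows "theta1 \<tau> u = theta1_scale * exp (- (of_real pi * \<i> * u)) * q_prod (nome \<tau>) w * q_prod (nome \<tau>) (nome \<tau> / w)"
proof -
  define q where "q = nome \<tau>"
  have w0: "w \<noteq> 0" by (simp add: w_def)
  have nq: "norm q < 1" using norm_nome by (simp add: q_def)
  define s where "s = exp (of_real pi * \<i> * u)"
  have ws: "w = s ^ 2" and s0: "s \<noteq> 0"
    by (simp_all add: w_def s_def exp_double[symmetric] mult_ac)
  have cosw: "2 * cos (2 * of_real pi * u) = w + 1 / w"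
    by (simp add: cos_exp_eq w_def exp_minus field_simps)
  have sinw: "2 * sin (of_real pi * u) = \<i> * exp (- (of_real pi * \<i> * u)) * (1 - w)"
    unfolding sin_exp_eq ws using s0
    by (simp add: s_def exp_minus field_simps power2_eq_square)
  have "(\<Prod>n. 1 - 2 * q ^ Suc n * cos (2 * of_real pi * u) + q ^ (2 * Suc n))
     = (\<Prod>n. (1 - q ^ n * (q * w)) * (1 - q ^ n * (q / w)))"
  proof (rule prodinf_cong)
    fix n
    define Q where "Q = q ^ Suc n"
    have "1 - 2 * Q * cos (2 * of_real pi * u) + Q ^ 2 = 1 - Q * (w + 1 / w) + Q ^ 2"
      unfolding cosw[symmetric] by simp
    also have "\<dots> = (1 - Q * w) * (1 - Q / w)"
      using w0 by (simp add: field_simps power2_eq_square)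
    finally have "1 - 2 * Q * cos (2 * of_real pi * u) + Q ^ 2 = (1 - Q * w) * (1 - Q / w)" .
    moreover have "q ^ (2 * Suc n) = Q ^ 2"
      unfolding Q_def power_mult[symmetric] by (simp only: mult.commute)
    ultimately show "1 - 2 * q ^ Suc n * cos (2 * of_real pi * u) + q ^ (2 * Suc n)
        = (1 - q ^ n * (q * w)) * (1 - q ^ n * (q / w))"
      by (simp add: Q_def mult_ac)
  qed
  also have "\<dots> = q_prod q (q * w) * q_prod q (q / w)"
    unfolding q_prod_def by (intro prodinf_mult[symmetric] q_prod_convergent nq)
  finally have H: "(\<Prod>n. 1 - 2 * q ^ Suc n * cos (2 * of_real pi * u) + q ^ (2 * Suc n))
     = q_prod q (q * w) * q_prod q (q / w)" .
  have P: "(\<Prod>n. 1 - q ^ Suc n) = q_prod q q"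
    by (simp add: q_prod_def mult_ac)
  have "theta1 \<tau> u = exp (of_real pi * \<i> * \<tau> / 4) * q_prod q q * (2 * sin (of_real pi * u))
      * (q_prod q (q * w) * q_prod q (q / w))"
    unfolding theta1_def q_def[symmetric] H P by simp
  also have "\<dots> = theta1_scale * exp (- (of_real pi * \<i> * u)) * ((1 - w) * q_prod q (q * w)) * q_prod q (q / w)"
    unfolding sinw theta1_scale_def q_def by simp
  finally show ?thesis
    unfolding q_prod_step[OF nq, of w, symmetric] by (simp add: q_def)
qed

lemma theta1_holomorphic: "theta1 \<tau> holomorphic_on UNIV"
proof -
  have comp: "(\<lambda>u. q_prod (nome \<tau>) (f u)) holomorphic_on UNIV" if "f holomorphic_on UNIV" for f
    using holomorphic_on_compose_gen[OF that q_prod_holomorphic[OF norm_nome]] by (simp add: o_def)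
  show ?thesis
    unfolding theta1_eq_q_prod[abs_def] by (intro holomorphic_intros comp) auto
qed

lemma theta1_field_differentiable: "theta1 \<tau> field_differentiable at u"
  using theta1_holomorphic by (simp add: holomorphic_on_def)

lemma theta1_continuous: "continuous_on A f \<Longrightarrow> continuous_on A (\<lambda>z. theta1 \<tau> (f z))"
  using continuous_on_compose2[OF holomorphic_on_imp_continuous_on[OF theta1_holomorphic]] by auto

lemma theta1_add_one: "theta1 \<tau> (u + 1) = - theta1 \<tau> u"
proof -
  have "exp (2 * of_real pi * \<i> * (u + 1)) = exp (2 * of_real pi * \<i> * u)"
    using exp_plus_2pin[of "2 * of_real pi * \<i> * u" 1] by (simp add: algebra_simps)
  moreover have "exp (- (of_real pi * \<i> * (u + 1))) = - exp (- (of_real pi * \<i> * u))"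
    by (simp add: ring_distribs exp_diff)
  ultimately show ?thesis
    by (simp add: theta1_eq_q_prod)
qed

text \<open>
  Under \<open>w \<mapsto> p w\<close> the product in \<open>w\<close> loses its factor \<open>1 - w\<close> and the product in \<open>p / w\<close>
  gains a factor \<open>1 - 1 / w\<close>; their ratio is \<open>- 1 / w\<close>.
\<close>

lemma theta1_add_tau: "theta1 \<tau> (u + \<tau>) = - exp (- (of_real pi * \<i> * (2 * u + \<tau>))) * theta1 \<tau> u"
proof -
  define q where "q = nome \<tau>"
  define w where "w = exp (2 * of_real pi * \<i> * u)"
  have nz: "q \<noteq> 0" "w \<noteq> 0" by (auto simp: q_def w_def nome_nonzero)
  have nq: "norm q < 1" using norm_nome by (simp add: q_def)
  have wq: "exp (2 * of_real pi * \<i> * (u + \<tau>)) = q * w"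
    by (simp add: q_def w_def nome_def ring_distribs exp_add)
  have "theta1 \<tau> (u + \<tau>) = theta1_scale * exp (- (of_real pi * \<i> * (u + \<tau>))) * (q_prod q (q * w) * q_prod q (1 / w))"
    unfolding theta1_eq_q_prod wq q_def[symmetric] using nz by simp
  also have "q_prod q (q * w) * q_prod q (1 / w) = q_prod q (q * w) * ((1 - 1 / w) * q_prod q (q / w))"
    using q_prod_step[OF nq, of "1 / w"] by simp
  also have "\<dots> = - (1 / w) * (((1 - w) * q_prod q (q * w)) * q_prod q (q / w))"
    using nz by (simp add: field_simps)
  also have "\<dots> = - (1 / w) * (q_prod q w * q_prod q (q / w))"
    using q_prod_step[OF nq, of w] by simp
  also have "theta1_scale * exp (- (of_real pi * \<i> * (u + \<tau>))) * \<dots> =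
      - (exp (- (of_real pi * \<i> * \<tau>)) / w) * theta1 \<tau> u"
    unfolding theta1_eq_q_prod w_def[symmetric] q_def[symmetric]
    by (simp add: ring_distribs exp_diff exp_minus field_simps)
  also have "exp (- (of_real pi * \<i> * \<tau>)) / w = exp (- (of_real pi * \<i> * (2 * u + \<tau>)))"
    by (simp add: w_def exp_diff[symmetric] algebra_simps)
  finally show ?thesis .
qed

lemma theta1_minus: "theta1 \<tau> (- u) = - theta1 \<tau> u"
  by (simp add: theta1_def)

lemma theta1_0: "theta1 \<tau> 0 = 0"
  by (simp add: theta1_def)

lemma theta1_nonzero:
  assumes "u \<notin> period_lattice \<tau>"
  shows "theta1 \<tau> u \<noteq> 0"
proof -
  define w where "w = exp (2 * of_real pi * \<i> * u)"
  have lat: "exp (2 * of_real pi * \<i> * (of_int b * \<tau> + u)) \<noteq> 1" for b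
  proof
    assume "exp (2 * of_real pi * \<i> * (of_int b * \<tau> + u)) = 1"
    then have "exp (2 * of_real pi * \<i> * (of_int b * \<tau> + u)) = exp 0"
      by simp
    then obtain a :: int where "2 * of_real pi * \<i> * (of_int b * \<tau> + u) = of_real (of_int (2 * a) * pi) * \<i>"
      unfolding exp_eq by auto
    then have "(2 * of_real pi * \<i>) * (of_int b * \<tau> + u) = (2 * of_real pi * \<i>) * of_int a"
      by (simp add: mult_ac)
    then have "of_int b * \<tau> + u = of_int a"
      by (subst (asm) mult_left_cancel) auto
    then have "u = of_int a + of_int (- b) * \<tau>"
      by (simp add: algebra_simps)
    then show False using assms unfolding period_lattice_def by blast
  qed
  have "nome \<tau> ^ n * w \<noteq> 1" for n
    using lat[of "int n"] by (simp add: nome_power w_def exp_add[symmetric] ring_distribs)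
  moreover have "nome \<tau> ^ n * (nome \<tau> / w) \<noteq> 1" for n
  proof
    assume "nome \<tau> ^ n * (nome \<tau> / w) = 1"
    then have "nome \<tau> ^ Suc n = w"
      by (simp add: w_def mult_ac)
    then have "exp (2 * of_real pi * \<i> * (of_int (- int (Suc n)) * \<tau> + u)) = 1"
      unfolding nome_power w_def by (simp add: ring_distribs exp_diff exp_add exp_minus field_simps)
    then show False using lat by blast
  qed
  ultimately show ?thesis
    unfolding theta1_eq_q_prod w_def[symmetric]
    by (simp add: theta1_scale_nonzero q_prod_nonzero norm_nome)
qed

text \<open>
  The zero comes from the factor \<open>1 - w\<close> alone; the cofactor \<open>H\<close> does not vanish at \<open>0\<close>.
\<close>

lemma deriv_theta1_0: "deriv (theta1 \<tau>) 0 \<noteq> 0"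
proof -
  define q where "q = nome \<tau>"
  define H where "H = (\<lambda>u. theta1_scale * exp (- (of_real pi * \<i> * u)) * q_prod q (q * exp (2 * of_real pi * \<i> * u))
     * q_prod q (q / exp (2 * of_real pi * \<i> * u)))"
  have nq: "norm q < 1" using norm_nome by (simp add: q_def)
  have comp: "(\<lambda>u. q_prod q (f u)) holomorphic_on UNIV" if "f holomorphic_on UNIV" for f
    using holomorphic_on_compose_gen[OF that q_prod_holomorphic[OF nq]] by (simp add: o_def)
  have "H holomorphic_on UNIV"
    unfolding H_def by (intro holomorphic_intros comp) auto
  then have dH: "(H has_field_derivative deriv H 0) (at 0)"
    by (auto intro: holomorphic_derivI)
  have eq: "theta1 \<tau> = (\<lambda>u. (1 - exp (2 * of_real pi * \<i> * u)) * H u)"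
    unfolding H_def theta1_eq_q_prod[abs_def] q_def[symmetric]
    by (subst q_prod_step[OF nq, of "exp _"]) (simp add: mult_ac)
  have "(theta1 \<tau> has_field_derivative (- (2 * of_real pi * \<i>) * H 0)) (at 0)"
    unfolding eq by (rule derivative_eq_intros dH refl | simp)+
  then have "deriv (theta1 \<tau>) 0 = - (2 * of_real pi * \<i>) * H 0"
    by (rule DERIV_imp_deriv)
  moreover have "H 0 = theta1_scale * q_prod q q * q_prod q q"
    by (simp add: H_def)
  moreover have "q_prod q q \<noteq> 0"
    using theta1_scale_nonzero by (simp add: theta1_scale_def q_def)
  ultimately show ?thesis
    using theta1_scale_nonzero by simp
qed

text \<open>
  Quasi-periodicity moves zeros to zeros without preserving values, so it is used in the form of
  properties that are invariant under the two generators.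
\<close>

lemma lattice_invariant:
  assumes "\<And>z. Q (z + 1) \<longleftrightarrow> Q z" "\<And>z. Q (z + \<tau>) \<longleftrightarrow> Q z" "\<omega> \<in> period_lattice \<tau>"
  shows "Q (z + \<omega>) \<longleftrightarrow> Q z"
proof -
  have shift: "Q (z + of_int n * c) \<longleftrightarrow> Q z" if "\<And>z. Q (z + c) \<longleftrightarrow> Q z" for z c and n :: int
  proof (induction n rule: int_induct[of _ 0])
    case (step1 i)
    then show ?case using that[of "z + of_int i * c"] by (simp add: ring_distribs add_ac)
  next
    case (step2 i)
    then show ?case using that[of "z + of_int (i - 1) * c"] by (simp add: ring_distribs)
  qed simp
  obtain a b :: int where "\<omega> = of_int a + of_int b * \<tau>"
    using assms(3) by (auto simp: period_lattice_def)
  then show ?thesis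
    using shift[of 1, OF assms(1), of z a] shift[of \<tau>, OF assms(2), of "z + of_int a" b]
    by (simp add: add_ac)
qed

text \<open>
  Zeros are lattice points, and differentiating the two functional equations at a zero shows that
  simplicity is invariant under lattice translations; at \<open>0\<close> it is \<open>deriv_theta1_0\<close>.
\<close>

lemma theta1_simple_zero:
  assumes "theta1 \<tau> u = 0"
  shows "deriv (theta1 \<tau>) u \<noteq> 0"
proof -
  have u: "u \<in> period_lattice \<tau>"
    using assms theta1_nonzero by blast
  have d: "deriv (\<lambda>u. theta1 \<tau> (u + c)) u = deriv (theta1 \<tau>) (u + c)" for u c
  proof -
    have "((\<lambda>u. theta1 \<tau> (u + c)) has_field_derivative deriv (theta1 \<tau>) (u + c)) (at u)"
      using field_differentiable_derivI[OF theta1_field_differentiable[of "u + c"]]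
      unfolding DERIV_shift .
    then show ?thesis by (rule DERIV_imp_deriv)
  qed
  have "theta1 \<tau> (0 + u) = 0 \<and> deriv (theta1 \<tau>) (0 + u) \<noteq> 0 \<longleftrightarrow>
        theta1 \<tau> 0 = 0 \<and> deriv (theta1 \<tau>) 0 \<noteq> 0"
  proof (rule lattice_invariant[OF _ _ u])
    fix z
    have "deriv (theta1 \<tau>) (z + 1) = - deriv (theta1 \<tau>) z"
      using d[of 1 z] theta1_field_differentiable by (simp add: theta1_add_one)
    then show "theta1 \<tau> (z + 1) = 0 \<and> deriv (theta1 \<tau>) (z + 1) \<noteq> 0 \<longleftrightarrow>
        theta1 \<tau> z = 0 \<and> deriv (theta1 \<tau>) z \<noteq> 0"
      by (simp add: theta1_add_one)
    define E where "E = (\<lambda>u. - exp (- (of_real pi * \<i> * (2 * u + \<tau>))))"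
    have dE: "E field_differentiable at z"
      unfolding E_def field_differentiable_def by (rule exI derivative_eq_intros refl)+
    have E: "theta1 \<tau> (z + \<tau>) = E z * theta1 \<tau> z" for z
      by (simp add: E_def theta1_add_tau)
    have "deriv (theta1 \<tau>) (z + \<tau>) = E z * deriv (theta1 \<tau>) z" if "theta1 \<tau> z = 0"
      using d[of \<tau> z] dE theta1_field_differentiable[of z] that unfolding E
      by (simp add: deriv_mult)
    then show "theta1 \<tau> (z + \<tau>) = 0 \<and> deriv (theta1 \<tau>) (z + \<tau>) \<noteq> 0 \<longleftrightarrow>
        theta1 \<tau> z = 0 \<and> deriv (theta1 \<tau>) z \<noteq> 0"
      unfolding E by (auto simp: E_def)
  qed
  then show ?thesis
    using theta1_0 deriv_theta1_0 by simp
qed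

end

section \<open>Entire functions\<close>

text \<open>
  Identities obtained after dividing by a function with countably many zeros, or for all but
  countably many parameter values, extend to the exceptional points by continuity: a countable
  set contains no ball.
\<close>

lemma eq_if_eq_off_countable:
  fixes f g :: "complex \<Rightarrow> complex"
  assumes "continuous_on UNIV f" "continuous_on UNIV g" "countable S"
    and eq: "\<And>z. z \<notin> S \<Longrightarrow> f z = g z"
  shows "f z = g z"
proof (rule ccontr)
  assume "f z \<noteq> g z"
  moreover have "open {z. f z \<noteq> g z}"
    using assms(1,2) by (rule open_Collect_neq)
  ultimately obtain e where "e > 0" "ball z e \<subseteq> {z. f z \<noteq> g z}"
    unfolding open_contains_ball by blast
  then have "ball z e \<subseteq> S" using eq by blast
  then show False
    using \<open>e > 0\<close> \<open>countable S\<close> countable_subset uncountable_ball by blast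
qed

text \<open>
  Near a common zero \<open>a\<close>, divide numerator and denominator by \<open>z - a\<close>. Both difference quotients
  are holomorphic, and the one in the denominator is nonzero at \<open>a\<close> by simplicity of the zero.
\<close>

lemma entire_quotient_simple_zeros:
  assumes f: "f holomorphic_on UNIV" and g: "g holomorphic_on UNIV"
    and z: "\<And>z. g z = 0 \<Longrightarrow> f z = 0 \<and> deriv g z \<noteq> 0"
  obtains h where "h holomorphic_on UNIV" "\<And>z. f z = h z * g z"
proof
  define h where "h = (\<lambda>z. if g z = 0 then deriv f z / deriv g z else f z / g z)"
  show "f z = h z * g z" for z
    using z[of z] by (simp add: h_def)
  have "h field_differentiable at a" for a
  proof (cases "g a = 0")
    case False
    have "open {z. g z \<noteq> 0}"
      using holomorphic_on_imp_continuous_on[OF g] by (intro open_Collect_neq continuous_intros)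
    moreover have "(\<lambda>z. f z / g z) holomorphic_on {z. g z \<noteq> 0}"
      using f g by (intro holomorphic_on_divide) (auto intro: holomorphic_on_subset)
    then have "h holomorphic_on {z. g z \<noteq> 0}"
      by (rule holomorphic_transform) (simp add: h_def)
    ultimately show ?thesis
      using False by (auto simp: holomorphic_on_imp_differentiable_at)
  next
    case True
    define F where "F = (\<lambda>z. if z = a then deriv f a else (f z - f a) / (z - a))"
    define G where "G = (\<lambda>z. if z = a then deriv g a else (g z - g a) / (z - a))"
    have F: "F holomorphic_on UNIV" and G: "G holomorphic_on UNIV"
      unfolding F_def G_def using f g by (auto intro: pole_lemma_open)
    have "open {z. G z \<noteq> 0}"
      using holomorphic_on_imp_continuous_on[OF G] by (intro open_Collect_neq continuous_intros)
    moreover have "(\<lambda>z. F z / G z) holomorphic_on {z. G z \<noteq> 0}"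
      using F G by (intro holomorphic_on_divide) (auto intro: holomorphic_on_subset)
    then have "h holomorphic_on {z. G z \<noteq> 0}"
      by (rule holomorphic_transform) (use True z[OF True] in \<open>auto simp: h_def F_def G_def\<close>)
    moreover have "G a \<noteq> 0"
      using z[OF True] by (simp add: G_def)
    ultimately show ?thesis
      by (auto simp: holomorphic_on_imp_differentiable_at)
  qed
  then show "h holomorphic_on UNIV"
    by (simp add: holomorphic_on_def)
qed

context upper_half_plane
begin

text \<open>
  All values are attained on the compact period parallelogram, so Liouville's theorem applies.
\<close>

lemma doubly_periodic_entire_const:
  assumes h: "h holomorphic_on UNIV" and per: "\<And>z. h (z + 1) = h z" "\<And>z. h (z + \<tau>) = h z"
  shows "h z = h w"
proof -
  define para where "para = (\<lambda>(s, t). complex_of_real s + of_real t * \<tau>) ` ({0..1} \<times> {0..1})"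
  have "compact para"
    unfolding para_def
    by (intro compact_continuous_image compact_Times)
       (auto simp: case_prod_unfold intro!: continuous_intros)
  then have "bounded (h ` para)"
    using holomorphic_on_imp_continuous_on[OF h]
    by (metis compact_continuous_image compact_imp_bounded continuous_on_subset top_greatest)
  moreover have "range h \<subseteq> h ` para"
  proof
    fix y assume "y \<in> range h"
    then obtain z where y: "y = h z" by auto
    define t where "t = Im z / Im \<tau>"
    define s where "s = Re z - t * Re \<tau>"
    have z: "z = of_real s + of_real t * \<tau>"
      using Im_tau by (simp add: complex_eq_iff s_def t_def)
    define z' where "z' = of_real (frac s) + of_real (frac t) * \<tau>"
    have "z = z' + (of_int \<lfloor>s\<rfloor> + of_int \<lfloor>t\<rfloor> * \<tau>)"
      unfolding z z'_def frac_def by (simp add: algebra_simps)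
    moreover have "h (z' + (of_int \<lfloor>s\<rfloor> + of_int \<lfloor>t\<rfloor> * \<tau>)) = y \<longleftrightarrow> h z' = y"
      by (rule lattice_invariant) (auto simp: per period_lattice_def)
    moreover have "z' \<in> para"
      unfolding para_def z'_def
      by (intro image_eqI[of _ _ "(frac s, frac t)"]) (auto simp: frac_ge_0 frac_lt_1 less_imp_le)
    ultimately show "y \<in> h ` para" using y by (metis image_eqI)
  qed
  ultimately have "h constant_on UNIV"
    using Liouville_theorem[OF h] bounded_subset by blast
  then show ?thesis by (auto simp: constant_on_def)
qed

section \<open>The three-term identity\<close>

definition theta_pair :: "complex \<Rightarrow> complex \<Rightarrow> complex" where
  "theta_pair a z = theta1 \<tau> (a + z) * theta1 \<tau> (a - z)"

lemma theta_pair_holomorphic: "theta_pair a holomorphic_on UNIV"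
proof -
  have comp: "(\<lambda>z. theta1 \<tau> (f z)) holomorphic_on UNIV" if "f holomorphic_on UNIV" for f
    using holomorphic_on_compose_gen[OF that theta1_holomorphic] by (simp add: o_def)
  then show ?thesis
    unfolding theta_pair_def[abs_def] by (intro holomorphic_intros comp)
qed

lemma theta_pair_continuous:
  "continuous_on A f \<Longrightarrow> continuous_on A g \<Longrightarrow> continuous_on A (\<lambda>z. theta_pair (f z) (g z))"
  unfolding theta_pair_def by (intro continuous_intros theta1_continuous)

lemma theta_pair_minus: "theta_pair a (- z) = theta_pair a z"
  by (simp add: theta_pair_def mult.commute)

lemma theta_pair_self: "theta_pair a a = 0"
  by (simp add: theta_pair_def theta1_0)

lemma theta_pair_swap: "theta_pair b a = - theta_pair a b"
  using theta1_minus[of "a - b"] by (simp add: theta_pair_def add.commute)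

lemma theta_pair_add_one: "theta_pair a (z + 1) = theta_pair a z"
  using theta1_add_one[of "a + z"] theta1_add_one[of "a - (z + 1)"]
  by (simp add: theta_pair_def add.assoc)

lemma theta_pair_add_tau:
  "theta_pair a (z + \<tau>) = exp (- (2 * of_real pi * \<i> * (2 * z + \<tau>))) * theta_pair a z"
proof -
  have 1: "theta1 \<tau> (a + (z + \<tau>)) = - exp (- (of_real pi * \<i> * (2 * (a + z) + \<tau>))) * theta1 \<tau> (a + z)"
    using theta1_add_tau[of "a + z"] by (simp add: add.assoc)
  have "theta1 \<tau> (a - z) = - exp (- (of_real pi * \<i> * (2 * (a - (z + \<tau>)) + \<tau>))) * theta1 \<tau> (a - (z + \<tau>))"
    using theta1_add_tau[of "a - (z + \<tau>)"] by (simp add: algebra_simps)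
  then have 2: "theta1 \<tau> (a - (z + \<tau>)) = - exp (of_real pi * \<i> * (2 * (a - (z + \<tau>)) + \<tau>)) * theta1 \<tau> (a - z)"
    by (simp add: exp_minus)
  have "exp (- (of_real pi * \<i> * (2 * (a + z) + \<tau>))) * exp (of_real pi * \<i> * (2 * (a - (z + \<tau>)) + \<tau>))
      = exp (- (2 * of_real pi * \<i> * (2 * z + \<tau>)))"
    unfolding exp_add[symmetric] by (rule arg_cong[of _ _ exp]) (simp add: algebra_simps)
  then show ?thesis
    unfolding theta_pair_def 1 2 by simp
qed

lemma countable_theta1_zeros:
  assumes "inj f"
  shows "countable {z. theta1 \<tau> (f z) = 0}"
proof (rule countable_image_inj_on)
  have "period_lattice \<tau> = (\<lambda>(a, b). of_int a + of_int b * \<tau>) ` (UNIV :: (int \<times> int) set)"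
    by (auto simp: period_lattice_def)
  then have "countable (period_lattice \<tau>)"
    by simp
  moreover have "f ` {z. theta1 \<tau> (f z) = 0} \<subseteq> period_lattice \<tau>"
    using theta1_nonzero by blast
  ultimately show "countable (f ` {z. theta1 \<tau> (f z) = 0})"
    by (rule countable_subset[rotated])
  show "inj_on f {z. theta1 \<tau> (f z) = 0}"
    using assms by (rule inj_on_subset) simp
qed

lemma countable_theta_pair_zeros: "countable {z. theta_pair a z = 0}"
proof -
  have "{z. theta_pair a z = 0} = {z. theta1 \<tau> (a + z) = 0} \<union> {z. theta1 \<tau> (a - z) = 0}"
    by (auto simp: theta_pair_def)
  then show ?thesis
    by (auto intro!: countable_theta1_zeros simp: inj_def)
qed

lemma theta1_zero_add_lattice:
  assumes "\<omega> \<in> period_lattice \<tau>"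
  shows "theta1 \<tau> (u + \<omega>) = 0 \<longleftrightarrow> theta1 \<tau> u = 0"
  using assms by (rule lattice_invariant[rotated 2]) (auto simp: theta1_add_one theta1_add_tau)

text \<open>
  The condition \<open>\<theta>(2 a) \<noteq> 0\<close> prevents the two factors from vanishing together, since \<open>2 a\<close> is
  the sum of their arguments.
\<close>

lemma deriv_theta_pair_nonzero:
  assumes "theta1 \<tau> (2 * a) \<noteq> 0" "theta_pair a z = 0"
  shows "deriv (theta_pair a) z \<noteq> 0"
proof -
  have d: "(theta1 \<tau> has_field_derivative deriv (theta1 \<tau>) u) (at u)" for u
    using theta1_field_differentiable by (rule field_differentiable_derivI)
  have "((\<lambda>z. theta1 \<tau> (a + z)) has_field_derivative deriv (theta1 \<tau>) (a + z) * 1) (at z)"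
    by (rule DERIV_chain2[OF d]) (auto intro!: derivative_eq_intros)
  moreover have "((\<lambda>z. theta1 \<tau> (a - z)) has_field_derivative deriv (theta1 \<tau>) (a - z) * (- 1)) (at z)"
    by (rule DERIV_chain2[OF d]) (auto intro!: derivative_eq_intros)
  ultimately have "(theta_pair a has_field_derivative
      (deriv (theta1 \<tau>) (a + z) * theta1 \<tau> (a - z) - deriv (theta1 \<tau>) (a - z) * theta1 \<tau> (a + z))) (at z)"
    unfolding theta_pair_def[abs_def] using DERIV_mult by fastforce
  then have eq: "deriv (theta_pair a) z =
      deriv (theta1 \<tau>) (a + z) * theta1 \<tau> (a - z) - deriv (theta1 \<tau>) (a - z) * theta1 \<tau> (a + z)"
    by (rule DERIV_imp_deriv)
  have "\<not> (theta1 \<tau> (a + z) = 0 \<and> theta1 \<tau> (a - z) = 0)"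
  proof
    assume *: "theta1 \<tau> (a + z) = 0 \<and> theta1 \<tau> (a - z) = 0"
    then have "a + z \<in> period_lattice \<tau>" using theta1_nonzero by blast
    from theta1_zero_add_lattice[OF this, of "a - z"] * assms(1) show False
      by simp
  qed
  then show ?thesis
    using assms(2) theta1_simple_zero[of "a + z"] theta1_simple_zero[of "a - z"]
    unfolding eq by (auto simp: theta_pair_def)
qed

text \<open>
  The conditions exclude double zeros of \<open>theta_pair a\<close> and allow evaluation of the
  constant quotient at \<open>z = b\<close>.
\<close>

lemma weierstrass_three_term_generic:
  assumes a: "theta1 \<tau> (2 * a) \<noteq> 0" and ab: "theta_pair a b \<noteq> 0"
  shows "theta_pair a z * theta_pair b c + theta_pair b z * theta_pair c a + theta_pair c z * theta_pair a b = 0"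
proof -
  define D where "D = (\<lambda>z. theta_pair a z * theta_pair b c + theta_pair b z * theta_pair c a + theta_pair c z * theta_pair a b)"
  have D1: "D (z + 1) = D z" for z
    by (simp add: D_def theta_pair_add_one)
  have Dt: "D (z + \<tau>) = exp (- (2 * of_real pi * \<i> * (2 * z + \<tau>))) * D z" for z
    by (simp add: D_def theta_pair_add_tau ring_distribs mult_ac)
  have Da: "D a = 0" "D (- a) = 0"
    by (simp_all add: D_def theta_pair_minus theta_pair_self theta_pair_swap[of b a])
  have Db: "D b = 0"
    by (simp add: D_def theta_pair_self theta_pair_swap[of c b])
  have "D holomorphic_on UNIV"
    unfolding D_def by (intro holomorphic_intros theta_pair_holomorphic)
  moreover have "D z = 0 \<and> deriv (theta_pair a) z \<noteq> 0" if "theta_pair a z = 0" for z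
  proof
    have D_lattice: "D (z + \<omega>) = 0 \<longleftrightarrow> D z = 0" if "\<omega> \<in> period_lattice \<tau>" for z \<omega>
      using that by (rule lattice_invariant[rotated 2]) (auto simp: D1 Dt)
    from that consider "a + z \<in> period_lattice \<tau>" | "a - z \<in> period_lattice \<tau>"
      using theta1_nonzero by (auto simp: theta_pair_def)
    then show "D z = 0"
    proof cases
      case 1
      then show ?thesis using D_lattice[OF 1, of "- a"] Da by simp
    next
      case 2
      then show ?thesis using D_lattice[OF 2, of z] Da by simp
    qed
    show "deriv (theta_pair a) z \<noteq> 0"
      using a that by (rule deriv_theta_pair_nonzero)
  qed
  ultimately obtain h where h: "h holomorphic_on UNIV" and Dh: "\<And>z. D z = h z * theta_pair a z"
    using entire_quotient_simple_zeros[OF _ theta_pair_holomorphic[of a], of D] by metis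
  have hc: "continuous_on UNIV h" using h by (rule holomorphic_on_imp_continuous_on)
  have shift: "continuous_on UNIV (\<lambda>z. h (z + c))" for c
    by (rule continuous_on_compose2[OF hc]) (auto intro!: continuous_intros)
  have "h (z + 1) = h z" for z
  proof (rule eq_if_eq_off_countable[OF shift hc countable_theta_pair_zeros[of a]])
    fix z assume "z \<notin> {z. theta_pair a z = 0}"
    then show "h (z + 1) = h z" using D1[of z] by (simp add: Dh theta_pair_add_one)
  qed
  moreover have "h (z + \<tau>) = h z" for z
  proof (rule eq_if_eq_off_countable[OF shift hc countable_theta_pair_zeros[of a]])
    fix z assume "z \<notin> {z. theta_pair a z = 0}"
    then show "h (z + \<tau>) = h z" using Dt[of z] by (simp add: Dh theta_pair_add_tau)
  qed
  ultimately have "h z = h b"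
    by (rule doubly_periodic_entire_const[OF h])
  moreover have "h b = 0"
    using Dh[of b] Db ab by simp
  ultimately have "D z = 0"
    by (simp add: Dh)
  then show ?thesis by (simp add: D_def)
qed

text \<open>
  The parameters \<open>a\<close> violating the conditions of \<open>weierstrass_three_term_generic\<close> are countably
  many, so continuity in \<open>a\<close> removes them.
\<close>

lemma weierstrass_three_term:
  "theta_pair a z * theta_pair b c + theta_pair b z * theta_pair c a + theta_pair c z * theta_pair a b = 0"
proof (rule eq_if_eq_off_countable[where g = "\<lambda>_. 0" and z = a])
  show "countable ({a. theta1 \<tau> (2 * a) = 0} \<union> {a. theta_pair b a = 0})"
    by (auto intro!: countable_theta1_zeros countable_theta_pair_zeros simp: inj_def)
  fix a assume "a \<notin> {a. theta1 \<tau> (2 * a) = 0} \<union> {a. theta_pair b a = 0}"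
  then show "theta_pair a z * theta_pair b c + theta_pair b z * theta_pair c a
      + theta_pair c z * theta_pair a b = 0"
    by (intro weierstrass_three_term_generic) (auto simp: theta_pair_swap[of a b])
qed (intro continuous_intros theta_pair_continuous)+

lemma theta_pair_span:
  assumes "a + b \<notin> period_lattice \<tau>" "a - b \<notin> period_lattice \<tau>"
  shows "\<exists>A B. \<forall>z. theta_pair c z = A * theta_pair a z + B * theta_pair b z"
proof -
  have nz: "theta_pair a b \<noteq> 0"
    using assms theta1_nonzero by (simp add: theta_pair_def)
  have "theta_pair c z = - (theta_pair b c / theta_pair a b) * theta_pair a z
     + - (theta_pair c a / theta_pair a b) * theta_pair b z" for z
    using weierstrass_three_term[of a z b c] nz
    by (simp add: field_simps eq_neg_iff_add_eq_0)
  then show ?thesis by blast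
qed

end

context upper_half_plane
begin

section \<open>The natural bases\<close>

definition bracket_pair :: "complex \<Rightarrow> complex \<Rightarrow> complex \<Rightarrow> complex" where
  "bracket_pair r c z = bracket \<tau> r (c + r * z) * bracket \<tau> r (c - r * z)"

lemma bracket_const_nonzero: "bracket_const \<tau> r \<noteq> 0"
  using Im_tau by (auto simp: bracket_const_def x_pow_def)

lemma bracket_pair_eq:
  assumes "r \<noteq> 0"
  shows "bracket_pair r c z = (bracket_const \<tau> r)\<^sup>2 * theta_pair (c / r) z"
  using assms by (simp add: bracket_pair_def bracket_def theta_pair_def add_divide_distrib
      diff_divide_distrib power2_eq_square)

lemma bracket_pair_span:
  assumes "r \<noteq> 0" "(a + b) / r \<notin> period_lattice \<tau>" "(a - b) / r \<notin> period_lattice \<tau>"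
  shows "\<exists>A B. \<forall>z. bracket_pair r c z = A * bracket_pair r a z + B * bracket_pair r b z"
proof -
  obtain A B where "\<And>z. theta_pair (c / r) z = A * theta_pair (a / r) z + B * theta_pair (b / r) z"
    using theta_pair_span[of "a / r" "b / r" "c / r"] assms(2,3)
    unfolding add_divide_distrib diff_divide_distrib by blast
  then show ?thesis
    unfolding bracket_pair_eq[OF assms(1)] by (intro exI[of _ A] exI[of _ B]) (simp add: ring_distribs mult_ac)
qed

lemma e_fun_eq_prod:
  "e_fun \<tau> r k n z \<alpha> \<beta> =
     (\<Prod>j<n. bracket_pair r (\<alpha> + of_nat j) z) * (\<Prod>j<k-n. bracket_pair r (\<beta> + of_nat j) z)"
  by (simp add: e_fun_def bracket_fact_def bracket_pair_def prod.distrib algebra_simps)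

lemma e_fun_mult_left:
  "e_fun \<tau> r k n z \<gamma> \<delta> * bracket_pair r (\<gamma> + of_nat n) z = e_fun \<tau> r (Suc k) (Suc n) z \<gamma> \<delta>"
  by (simp add: e_fun_eq_prod mult_ac)

lemma e_fun_mult_right:
  assumes "n \<le> k"
  shows "e_fun \<tau> r k n z \<gamma> \<delta> * bracket_pair r (\<delta> + of_nat (k - n)) z = e_fun \<tau> r (Suc k) n z \<gamma> \<delta>"
  using assms by (simp add: e_fun_eq_prod Suc_diff_le mult_ac)

lemma generic_pair_diff:
  "generic_pair \<tau> r k \<gamma> \<delta> \<Longrightarrow> \<bar>j\<bar> < int k \<Longrightarrow> (\<gamma> - \<delta> + of_int j) / r \<notin> period_lattice \<tau>"
  unfolding generic_pair_def by (drule conjunct1, drule bspec[of _ _ j]) auto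

lemma generic_pair_sum:
  "generic_pair \<tau> r k \<gamma> \<delta> \<Longrightarrow> 0 \<le> j \<Longrightarrow> j < int k \<Longrightarrow> (\<gamma> + \<delta> + of_int j) / r \<notin> period_lattice \<tau>"
  unfolding generic_pair_def by auto

lemma generic_pair_mono: "generic_pair \<tau> r k' \<gamma> \<delta> \<Longrightarrow> k \<le> k' \<Longrightarrow> generic_pair \<tau> r k \<gamma> \<delta>"
  unfolding generic_pair_def by auto

lemma generic_pair_shift:
  assumes "generic_pair \<tau> r (Suc k) \<gamma> \<delta>"
  shows "generic_pair \<tau> r k (\<gamma> + 1) \<delta>"
  unfolding generic_pair_def
proof (intro conjI ballI)
  fix j assume "j \<in> {1 - int k..int k - 1}"
  then have "(\<gamma> - \<delta> + of_int (j + 1)) / r \<notin> period_lattice \<tau>"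
      by (intro generic_pair_diff[OF assms]) auto
  then show "(\<gamma> + 1 - \<delta> + of_int j) / r \<notin> period_lattice \<tau>"
    by (simp add: algebra_simps)
next
  fix j assume "j \<in> {0..int k - 1}"
  then have "(\<gamma> + \<delta> + of_int (j + 1)) / r \<notin> period_lattice \<tau>"
      by (intro generic_pair_sum[OF assms]) auto
  then show "(\<gamma> + 1 + \<delta> + of_int j) / r \<notin> period_lattice \<tau>"
    by (simp add: algebra_simps)
qed

text \<open>
  In the induction step the new factor is expressed through the factors at \<open>\<gamma> + j\<close> and
  \<open>\<delta> + k - j\<close>, with coefficients \<open>A j\<close> and \<open>B j\<close> depending on the index \<open>j\<close> of the basis element
  that it multiplies. The sum of the two arguments is \<open>\<gamma> + \<delta> + k\<close> and their difference is
  \<open>\<gamma> - \<delta> + 2 j - k\<close>, with \<open>\<bar>2 j - k\<bar> \<le> k\<close>: both are covered by genericity of degree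
  \<open>k + 1\<close>, the degree reached by this step.
\<close>

lemma prod_bracket_pair_expansion:
  assumes "r \<noteq> 0" "generic_pair \<tau> r (length cs) \<gamma> \<delta>"
  shows "\<exists>R. \<forall>z. (\<Prod>c\<leftarrow>cs. bracket_pair r c z) = (\<Sum>j=0..length cs. R j * e_fun \<tau> r (length cs) j z \<gamma> \<delta>)"
  using assms(2)
proof (induction cs)
  case Nil
  show ?case by (intro exI[of _ "\<lambda>_. 1"]) (simp add: e_fun_eq_prod)
next
  case (Cons c cs)
  define k where "k = length cs"
  have gen: "generic_pair \<tau> r (Suc k) \<gamma> \<delta>"
    using Cons.prems by (simp add: k_def)
  obtain R where R: "\<And>z. (\<Prod>c\<leftarrow>cs. bracket_pair r c z) = (\<Sum>j=0..k. R j * e_fun \<tau> r k j z \<gamma> \<delta>)"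
    using Cons.IH generic_pair_mono[OF gen, of k] by (auto simp: k_def)
  have "\<exists>A B. \<forall>z. bracket_pair r c z =
      A * bracket_pair r (\<gamma> + of_nat j) z + B * bracket_pair r (\<delta> + of_nat (k - j)) z" if "j \<le> k" for j
  proof (rule bracket_pair_span[OF assms(1)])
    have "(\<gamma> + \<delta> + of_int (int k)) / r \<notin> period_lattice \<tau>"
      by (intro generic_pair_sum[OF gen]) auto
    then show "(\<gamma> + of_nat j + (\<delta> + of_nat (k - j))) / r \<notin> period_lattice \<tau>"
      using that by (simp add: of_nat_diff algebra_simps)
    have "(\<gamma> - \<delta> + of_int (2 * int j - int k)) / r \<notin> period_lattice \<tau>"
      using that by (intro generic_pair_diff[OF gen]) auto
    then show "(\<gamma> + of_nat j - (\<delta> + of_nat (k - j))) / r \<notin> period_lattice \<tau>"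
      using that by (simp add: of_nat_diff algebra_simps)
  qed
  then obtain A B where AB: "\<And>j z. j \<le> k \<Longrightarrow> bracket_pair r c z =
      A j * bracket_pair r (\<gamma> + of_nat j) z + B j * bracket_pair r (\<delta> + of_nat (k - j)) z"
    by metis
  define S where "S = (\<lambda>j. (if j = 0 then 0 else R (j - 1) * A (j - 1)) + (if j \<le> k then R j * B j else 0))"
  \<comment> \<open>The coefficient of index \<open>j\<close> collects the contributions of indices \<open>j - 1\<close> and \<open>j\<close>; each is absent at one end.\<close>
  have "(\<Prod>c\<leftarrow>c # cs. bracket_pair r c z) = (\<Sum>j=0..Suc k. S j * e_fun \<tau> r (Suc k) j z \<gamma> \<delta>)" for z
  proof -
    have "(\<Prod>c\<leftarrow>c # cs. bracket_pair r c z) = (\<Sum>j=0..k. R j * e_fun \<tau> r k j z \<gamma> \<delta> * bracket_pair r c z)"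
      by (simp add: R sum_distrib_left mult.commute)
    also have "\<dots> = (\<Sum>j=0..k. R j * A j * e_fun \<tau> r (Suc k) (Suc j) z \<gamma> \<delta>
        + R j * B j * e_fun \<tau> r (Suc k) j z \<gamma> \<delta>)"
    proof (rule sum.cong[OF refl])
      fix j assume "j \<in> {0..k}"
      then have j: "j \<le> k" by simp
      show "R j * e_fun \<tau> r k j z \<gamma> \<delta> * bracket_pair r c z
        = R j * A j * e_fun \<tau> r (Suc k) (Suc j) z \<gamma> \<delta> + R j * B j * e_fun \<tau> r (Suc k) j z \<gamma> \<delta>"
        unfolding AB[OF j] e_fun_mult_left[symmetric] e_fun_mult_right[OF j, symmetric]
        by (simp add: algebra_simps)
    qed
    also have "\<dots> = (\<Sum>j=0..k. R j * A j * e_fun \<tau> r (Suc k) (Suc j) z \<gamma> \<delta>)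
        + (\<Sum>j=0..k. R j * B j * e_fun \<tau> r (Suc k) j z \<gamma> \<delta>)"
      by (rule sum.distrib)
    also have "(\<Sum>j=0..k. R j * A j * e_fun \<tau> r (Suc k) (Suc j) z \<gamma> \<delta>) =
        (\<Sum>j=0..Suc k. (if j = 0 then 0 else R (j - 1) * A (j - 1)) * e_fun \<tau> r (Suc k) j z \<gamma> \<delta>)"
      by (subst sum.atLeast0_atMost_Suc_shift) simp
    also have "(\<Sum>j=0..k. R j * B j * e_fun \<tau> r (Suc k) j z \<gamma> \<delta>) =
        (\<Sum>j=0..Suc k. (if j \<le> k then R j * B j else 0) * e_fun \<tau> r (Suc k) j z \<gamma> \<delta>)"
      by simp
    finally show ?thesis
      by (simp only: S_def sum.distrib[symmetric] ring_distribs)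
  qed
  then show ?case by (auto simp: k_def)
qed

lemma e_fun_expansion:
  assumes "r \<noteq> 0" "generic_pair \<tau> r k \<gamma> \<delta>" "n \<le> k"
  shows "\<exists>R. \<forall>z. e_fun \<tau> r k n z \<alpha> \<beta> = (\<Sum>j=0..k. R j * e_fun \<tau> r k j z \<gamma> \<delta>)"
proof -
  define cs where "cs = map (\<lambda>j. \<alpha> + of_nat j) [0..<n] @ map (\<lambda>j. \<beta> + of_nat j) [0..<k - n]"
  have "length cs = k" using assms(3) by (simp add: cs_def)
  moreover have "(\<Prod>c\<leftarrow>cs. bracket_pair r c z) = e_fun \<tau> r k n z \<alpha> \<beta>" for z
    by (simp add: cs_def e_fun_eq_prod o_def prod.distinct_set_conv_list[symmetric] lessThan_atLeast0)
  ultimately show ?thesis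
    using prod_bracket_pair_expansion[OF assms(1), of cs \<gamma> \<delta>] assms(2) by simp
qed

lemma e_fun_continuous: "r \<noteq> 0 \<Longrightarrow> continuous_on UNIV (\<lambda>z. e_fun \<tau> r k n z \<alpha> \<beta>)"
  unfolding e_fun_eq_prod bracket_pair_eq by (intro continuous_intros theta_pair_continuous)

text \<open>
  Induction on \<open>k\<close> with \<open>\<gamma>\<close> arbitrary: after removal of the term of index \<open>0\<close>, the common
  factor \<open>bracket_pair r \<gamma>\<close> is cancelled, which replaces \<open>\<gamma>\<close> by \<open>\<gamma> + 1\<close>. Evaluating
  at the further zeros \<open>(\<gamma> + i)/r\<close> would not isolate the next coefficients, since this factor may
  itself vanish there.
\<close>

lemma e_fun_independent:
  assumes "r \<noteq> 0" "generic_pair \<tau> r k \<gamma> \<delta>"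
    and "\<And>z. (\<Sum>j=0..k. a j * e_fun \<tau> r k j z \<gamma> \<delta>) = 0" and "j \<le> k"
  shows "a j = 0"
  using assms(2-)
proof (induction k arbitrary: \<gamma> a j)
  case 0
  from "0.prems"(2)[of 0] "0.prems"(3) show ?case by (simp add: e_fun_eq_prod)
next
  case (Suc k)
  have factor: "e_fun \<tau> r (Suc k) (Suc j) z \<gamma> \<delta> = bracket_pair r \<gamma> z * e_fun \<tau> r k j z (\<gamma> + 1) \<delta>" for j z
    unfolding e_fun_eq_prod by (simp add: prod.lessThan_Suc_shift add_ac del: prod.lessThan_Suc)
  \<comment> \<open>The zero at \<open>\<gamma>/r\<close> is carried by the common factor of all terms but the first.\<close>
  have shift: "(\<Sum>j=0..Suc k. a j * e_fun \<tau> r (Suc k) j z \<gamma> \<delta>) = a 0 * e_fun \<tau> r (Suc k) 0 z \<gamma> \<delta>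
      + bracket_pair r \<gamma> z * (\<Sum>j=0..k. a (Suc j) * e_fun \<tau> r k j z (\<gamma> + 1) \<delta>)" for z
    by (subst sum.atLeast0_atMost_Suc_shift) (simp add: factor sum_distrib_left mult_ac)
  have "bracket_pair r \<gamma> (\<gamma> / r) = 0"
    using assms(1) by (simp add: bracket_pair_eq theta_pair_self)
  then have "a 0 * e_fun \<tau> r (Suc k) 0 (\<gamma> / r) \<gamma> \<delta> = 0"
    using Suc.prems(2)[of "\<gamma> / r"] by (simp only: shift) simp
  moreover have "bracket_pair r (\<delta> + of_nat i) (\<gamma> / r) \<noteq> 0" if "i \<le> k" for i
  proof -
    have "(\<gamma> + \<delta> + of_int (int i)) / r \<notin> period_lattice \<tau>"
      using that by (intro generic_pair_sum[OF Suc.prems(1)]) auto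
    moreover have "(\<gamma> - \<delta> + of_int (- int i)) / r \<notin> period_lattice \<tau>"
      using that by (intro generic_pair_diff[OF Suc.prems(1)]) auto
    ultimately have "theta_pair (\<gamma> / r) ((\<delta> + of_nat i) / r) \<noteq> 0"
      unfolding theta_pair_def add_divide_distrib[symmetric] diff_divide_distrib[symmetric]
      using theta1_nonzero by (simp add: algebra_simps)
    then show ?thesis
      using assms(1) bracket_const_nonzero by (simp add: bracket_pair_eq theta_pair_swap[of _ "\<gamma> / r"])
  qed
  then have "e_fun \<tau> r (Suc k) 0 (\<gamma> / r) \<gamma> \<delta> \<noteq> 0"
    by (simp add: e_fun_eq_prod)
  ultimately have a0: "a 0 = 0" by simp
  have "(\<Sum>j=0..k. a (Suc j) * e_fun \<tau> r k j z (\<gamma> + 1) \<delta>) = 0" for z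
  proof (rule eq_if_eq_off_countable[where g = "\<lambda>_. 0" and z = z,
        OF _ _ countable_theta_pair_zeros[of "\<gamma> / r"]])
    show "continuous_on UNIV (\<lambda>z. \<Sum>j=0..k. a (Suc j) * e_fun \<tau> r k j z (\<gamma> + 1) \<delta>)"
      by (intro continuous_intros e_fun_continuous assms(1))
    fix z assume "z \<notin> {z. theta_pair (\<gamma> / r) z = 0}"
    then show "(\<Sum>j=0..k. a (Suc j) * e_fun \<tau> r k j z (\<gamma> + 1) \<delta>) = 0"
      using shift[of z] Suc.prems(2)[of z] a0 assms(1) bracket_const_nonzero
      by (simp add: bracket_pair_eq)
  qed simp
  from Suc.IH[OF generic_pair_shift[OF Suc.prems(1)] this] a0 Suc.prems(3) show ?case
    by (cases j) auto
qed

text \<open>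
  Existence and uniqueness of the coefficients make the definite description in the definition of
  the 6j-symbols meaningful.
\<close>

lemma elliptic_6j_expansion:
  assumes "r \<noteq> 0" "generic_pair \<tau> r k \<gamma> \<delta>" "n \<le> k"
  shows "e_fun \<tau> r k n z \<alpha> \<beta> = (\<Sum>m=0..k. elliptic_6j \<tau> r k n m \<alpha> \<beta> \<gamma> \<delta> * e_fun \<tau> r k m z \<gamma> \<delta>)"
proof -
  define P where "P = (\<lambda>R :: nat \<Rightarrow> complex. (\<forall>j>k. R j = 0) \<and>
     (\<forall>z. e_fun \<tau> r k n z \<alpha> \<beta> = (\<Sum>j=0..k. R j * e_fun \<tau> r k j z \<gamma> \<delta>)))"
  obtain R where R: "\<And>z. e_fun \<tau> r k n z \<alpha> \<beta> = (\<Sum>j=0..k. R j * e_fun \<tau> r k j z \<gamma> \<delta>)"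
    using e_fun_expansion[OF assms] by blast
  have "P (\<lambda>j. if j \<le> k then R j else 0)"
    unfolding P_def by (auto simp: R)
  moreover have "S = T" if "P S" "P T" for S T
  proof
    fix j
    show "S j = T j"
    proof (cases "j \<le> k")
      case True
      have "(\<Sum>j=0..k. (S j - T j) * e_fun \<tau> r k j z \<gamma> \<delta>) = 0" for z
        using that unfolding P_def by (simp add: left_diff_distrib sum_subtractf)
      from e_fun_independent[OF assms(1,2) this True] show ?thesis by simp
    qed (use that in \<open>simp add: P_def\<close>)
  qed
  ultimately have "P (THE R. P R)"
    by (metis theI)
  then show ?thesis
    unfolding elliptic_6j_def P_def by blast
qed

end

theorem proposition3p7:
  fixes \<tau> r \<alpha> \<beta> \<gamma> \<delta> :: complex and k n l :: nat
  assumes "Im \<tau> > 0" and "r \<noteq> 0"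
    and "k \<ge> 1" and "n \<le> k" and "l \<le> k"
    and "generic_pair \<tau> r k \<alpha> \<beta>" and "generic_pair \<tau> r k \<gamma> \<delta>"
  shows "(\<Sum>m=0..k. elliptic_6j \<tau> r k n m \<alpha> \<beta> \<gamma> \<delta> * elliptic_6j \<tau> r k m l \<gamma> \<delta> \<alpha> \<beta>)
         = (if n = l then 1 else 0)"
proof -
  interpret upper_half_plane \<tau> by unfold_locales (rule assms(1))
  \<comment> \<open>\<open>c l\<close> is the coefficient of index \<open>l\<close> after expanding from \<open>(\<alpha>, \<beta>)\<close> to \<open>(\<gamma>, \<delta>)\<close> and back.\<close>
  define c where "c = (\<lambda>l. \<Sum>m=0..k. elliptic_6j \<tau> r k n m \<alpha> \<beta> \<gamma> \<delta> * elliptic_6j \<tau> r k m l \<gamma> \<delta> \<alpha> \<beta>)"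
  have "(\<Sum>l=0..k. (c l - (if n = l then 1 else 0)) * e_fun \<tau> r k l z \<alpha> \<beta>) = 0" for z
  proof -
    have "e_fun \<tau> r k n z \<alpha> \<beta> = (\<Sum>m=0..k. elliptic_6j \<tau> r k n m \<alpha> \<beta> \<gamma> \<delta> * e_fun \<tau> r k m z \<gamma> \<delta>)"
      using assms by (intro elliptic_6j_expansion)
    also have "\<dots> = (\<Sum>m=0..k. elliptic_6j \<tau> r k n m \<alpha> \<beta> \<gamma> \<delta> *
        (\<Sum>l=0..k. elliptic_6j \<tau> r k m l \<gamma> \<delta> \<alpha> \<beta> * e_fun \<tau> r k l z \<alpha> \<beta>))"
      using assms by (intro sum.cong refl arg_cong2[of _ _ _ _ "(*)"] elliptic_6j_expansion) auto
    also have "\<dots> = (\<Sum>l=0..k. c l * e_fun \<tau> r k l z \<alpha> \<beta>)"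
      unfolding sum_distrib_left c_def sum_distrib_right by (subst sum.swap) (simp add: mult.assoc)
    finally have *: "e_fun \<tau> r k n z \<alpha> \<beta> = (\<Sum>l=0..k. c l * e_fun \<tau> r k l z \<alpha> \<beta>)" .
    have "(\<Sum>l=0..k. (if n = l then 1 else 0) * e_fun \<tau> r k l z \<alpha> \<beta>) =
        (\<Sum>l=0..k. if n = l then e_fun \<tau> r k l z \<alpha> \<beta> else 0)"
      by (intro sum.cong) auto
    also have "\<dots> = e_fun \<tau> r k n z \<alpha> \<beta>"
      using assms(4) by simp
    finally show ?thesis
      using * by (simp add: left_diff_distrib sum_subtractf)
  qed
  from e_fun_independent[OF assms(2,6) this assms(5)] show ?thesis
    by (simp add: c_def)
qed

end
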